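(* Let $n\ge 1$ and let $M$ be an integer with $2<M<2^n$ that is not a power of $2$. Write $M=\sum_{j=0}^{k}2^{l_j}$ with integers $0\le l_0<l_1<\dots<l_k\le n-1$. Let $\theta_0,\dots,\theta_{k-1}\in\mathbb{R}$ be arbitrary, and put $a_r=-\sin(\theta_r/2)$ and $b_r=\cos(\theta_r/2)$ for $0\le r\le k-1$ (so $|a_r|^2+|b_r|^2=1$). Then the $n$-qubit circuit $U_M(\theta_0,\dots,\theta_{k-1})$ defined in the context, which consists of $l_k+2k$ gates, satisfies $$U_M(\theta_0,\dots,\theta_{k-1})\,|0\rangle^{\otimes n}=\sum_{r=0}^{k}\gamma_r|\Gamma_r\rangle,$$ where $$|\Gamma_r\rangle=\sum_{j=0}^{2^{l_r}-1}\left|\,j+M-\sum_{s=0}^{r}2^{l_s}\right\rangle\qquad(0\le r\le k)$$ and $$\gamma_0=\frac{b_0}{\sqrt{2^{l_0}}},\qquad \gamma_r=\frac{a_0a_1\cdots a_{r-1}b_r}{\sqrt{2^{l_r}}}\ \ (0<r\le k-1),\qquad \gamma_k=\frac{a_0a_1\cdots a_{k-1}}{\sqrt{2^{l_k}}}.$$ In particular, every such state can be prepared on $\lceil\log_2 M\rceil$ qubits with gate count and circuit depth $O(\log_2 M)$, the implied constant being absolute.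
   Context: Qubits are labelled $q_{n-1},\dots,q_0$, and for an integer $0\le j<2^n$ with binary expansion $j=\sum_{i=0}^{n-1}j_i2^i$, $|j\rangle$ denotes the computational basis state $|j_{n-1}\rangle\otimes\cdots\otimes|j_0\rangle$, where $j_i$ is the value of qubit $q_i$. $X$ is the Pauli-$X$ gate, $H$ is the Hadamard gate, and $$R_Y(\theta)=\begin{bmatrix}\cos\frac{\theta}{2}&-\sin\frac{\theta}{2}\\ \sin\frac{\theta}{2}&\cos\frac{\theta}{2}\end{bmatrix}.$$ A single-qubit gate $V$ applied to a target qubit "conditioned on $q_c$ being $0$" means the two-qubit gate applying $V$ to the target if the control qubit $q_c$ is $|0\rangle$ and the identity if it is $|1\rangle$; it counts as one gate. Circuit depth is the minimal number of layers when the gates are arranged so that gates in one layer act on disjoint sets of qubits. The circuit $U_M(\theta_0,\dots,\theta_{k-1})$ applies the following gates in order. 1. Apply $X$ to $q_i$ for $i=l_1,l_2,\dots,l_k$. 2. If $l_0>0$, apply $H$ to $q_i$ for $i=0,1,\dots,l_0-1$. 3. Apply $R_Y(\theta_0)$ to $q_{l_1}$. 4. Apply $H$ to $q_i$ for each $i=l_0,\dots,l_1-1$, conditioned on $q_{l_1}$ being $0$. 5. For $m=1,2,\dots,k-1$ (in this order): apply $R_Y(\theta_m)$ to $q_{l_{m+1}}$ conditioned on $q_{l_m}$ being $0$; then apply $H$ to $q_i$ for each $i=l_m,\dots,l_{m+1}-1$, conditioned on $q_{l_{m+1}}$ being $0$. *)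

theory Defs
  imports Complex_Main "Jordan_Normal_Form.Matrix"
begin

section \<open>States and operators on qubit registers\<close>

definition kron_vec :: "complex vec \<Rightarrow> complex vec \<Rightarrow> complex vec" where
  "kron_vec u v = vec (dim_vec u * dim_vec v) (\<lambda>i. u $ (i div dim_vec v) * v $ (i mod dim_vec v))"

definition kron_mat :: "complex mat \<Rightarrow> complex mat \<Rightarrow> complex mat" where
  "kron_mat A B = mat (dim_row A * dim_row B) (dim_col A * dim_col B)
     (\<lambda>(i, j). A $$ (i div dim_row B, j div dim_col B) * B $$ (i mod dim_row B, j mod dim_col B))"

text \<open>The qubits are labelled \<open>n - 1, \<dots>, 0\<close> and qubit \<open>n - 1\<close> is the leftmost tensor factor,
  so qubit \<open>i\<close> carries the binary digit of weight \<open>2 ^ i\<close>.\<close>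

primrec ket :: "nat \<Rightarrow> nat \<Rightarrow> complex vec" where
  "ket 0 j = unit_vec 1 0"
| "ket (Suc n) j = kron_vec (unit_vec 2 (j div 2 ^ n mod 2)) (ket n j)"

text \<open>The single-qubit operator \<open>V\<close> on qubit \<open>t\<close> of \<open>n\<close>; meaningful only for \<open>t < n\<close>.\<close>

definition on_qubit :: "nat \<Rightarrow> nat \<Rightarrow> complex mat \<Rightarrow> complex mat" where
  "on_qubit n t V = kron_mat (1\<^sub>m (2 ^ (n - 1 - t))) (kron_mat V (1\<^sub>m (2 ^ t)))"

section \<open>Gates and circuits\<close>

datatype single_gate = PauliX | Hadamard | RotY real

fun single_mat :: "single_gate \<Rightarrow> complex mat" where
  "single_mat PauliX = mat_of_rows_list 2 [[0, 1], [1, 0]]"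
| "single_mat Hadamard = complex_of_real (1 / sqrt 2) \<cdot>\<^sub>m mat_of_rows_list 2 [[1, 1], [1, - 1]]"
| "single_mat (RotY \<theta>) = mat_of_rows_list 2
     [[complex_of_real (cos (\<theta> / 2)), - complex_of_real (sin (\<theta> / 2))],
      [complex_of_real (sin (\<theta> / 2)), complex_of_real (cos (\<theta> / 2))]]"

text \<open>\<open>Single V t\<close> applies \<open>V\<close> to qubit \<open>t\<close>; \<open>Ctrl0 V c t\<close> applies \<open>V\<close> to the target
  \<open>t\<close> conditioned on the control \<open>c\<close> being \<open>0\<close>.\<close>

datatype gate = Single single_gate nat | Ctrl0 single_gate nat nat

fun qubits :: "gate \<Rightarrow> nat set" where
  "qubits (Single V t) = {t}"
| "qubits (Ctrl0 V c t) = {c, t}"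

fun gate_on :: "nat \<Rightarrow> gate \<Rightarrow> bool" where
  "gate_on n (Single V t) \<longleftrightarrow> t < n"
| "gate_on n (Ctrl0 V c t) \<longleftrightarrow> c < n \<and> t < n \<and> c \<noteq> t"

fun gate_mat :: "nat \<Rightarrow> gate \<Rightarrow> complex mat" where
  "gate_mat n (Single V t) = on_qubit n t (single_mat V)"
| "gate_mat n (Ctrl0 V c t) =
     on_qubit n c (mat_of_rows_list 2 [[1, 0], [0, 0]]) * on_qubit n t (single_mat V)
     + on_qubit n c (mat_of_rows_list 2 [[0, 0], [0, 1]])"

text \<open>A circuit is the list of its gates, the first gate to be applied coming first.\<close>

type_synonym circuit = "gate list"

definition circuit_on :: "nat \<Rightarrow> circuit \<Rightarrow> bool" where
  "circuit_on n gs \<longleftrightarrow> (\<forall>g \<in> set gs. gate_on n g)"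

primrec circuit_mat :: "nat \<Rightarrow> circuit \<Rightarrow> complex mat" where
  "circuit_mat n [] = 1\<^sub>m (2 ^ n)"
| "circuit_mat n (g # gs) = circuit_mat n gs * gate_mat n g"

text \<open>\<open>layering gs d \<sigma>\<close>: gate number \<open>i\<close> is placed in layer \<open>\<sigma> i\<close>, one of \<open>d\<close> layers. Gates with a
  common qubit lie in different layers and keep their order, so executing the layers one after
  the other implements the circuit.\<close>

definition layering :: "circuit \<Rightarrow> nat \<Rightarrow> (nat \<Rightarrow> nat) \<Rightarrow> bool" where
  "layering gs d \<sigma> \<longleftrightarrow>
     (\<forall>i < length gs. \<sigma> i < d) \<and>
     (\<forall>i j. i < j \<and> j < length gs \<and> qubits (gs ! i) \<inter> qubits (gs ! j) \<noteq> {} \<longrightarrow> \<sigma> i < \<sigma> j)"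

definition depth :: "circuit \<Rightarrow> nat" where
  "depth gs = (LEAST d. \<exists>\<sigma>. layering gs d \<sigma>)"

section \<open>The circuit and the target state\<close>

definition U_circuit :: "nat \<Rightarrow> (nat \<Rightarrow> nat) \<Rightarrow> (nat \<Rightarrow> real) \<Rightarrow> circuit" where
  "U_circuit k l \<theta> =
     map (\<lambda>i. Single PauliX (l i)) [1..<k + 1]
     @ map (\<lambda>i. Single Hadamard i) [0..<l 0]
     @ [Single (RotY (\<theta> 0)) (l 1)]
     @ map (\<lambda>i. Ctrl0 Hadamard (l 1) i) [l 0..<l 1]
     @ concat (map (\<lambda>m.
          Ctrl0 (RotY (\<theta> m)) (l m) (l (m + 1))
          # map (\<lambda>i. Ctrl0 Hadamard (l (m + 1)) i) [l m..<l (m + 1)]) [1..<k])"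

definition amp_a :: "(nat \<Rightarrow> real) \<Rightarrow> nat \<Rightarrow> real" where
  "amp_a \<theta> r = - sin (\<theta> r / 2)"

definition amp_b :: "(nat \<Rightarrow> real) \<Rightarrow> nat \<Rightarrow> real" where
  "amp_b \<theta> r = cos (\<theta> r / 2)"

definition coeff_gamma :: "nat \<Rightarrow> (nat \<Rightarrow> nat) \<Rightarrow> (nat \<Rightarrow> real) \<Rightarrow> nat \<Rightarrow> real" where
  "coeff_gamma k l \<theta> r =
     (if r = 0 then amp_b \<theta> 0 / sqrt (2 ^ l 0)
      else if r < k then (\<Prod>s<r. amp_a \<theta> s) * amp_b \<theta> r / sqrt (2 ^ l r)
      else (\<Prod>s<k. amp_a \<theta> s) / sqrt (2 ^ l k))"

text \<open>When \<open>M\<close> is the sum of the \<open>2 ^ l s\<close> for \<open>s \<le> k\<close> and \<open>r \<le> k\<close>, the subtraction on natural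
  numbers does not truncate.\<close>

definition Gamma_state :: "nat \<Rightarrow> nat \<Rightarrow> (nat \<Rightarrow> nat) \<Rightarrow> nat \<Rightarrow> complex vec" where
  "Gamma_state n M l r =
     finsum_vec TYPE(complex) (2 ^ n) (\<lambda>j. ket n (j + M - (\<Sum>s\<le>r. 2 ^ l s))) {..<2 ^ l r}"

definition target_state ::
  "nat \<Rightarrow> nat \<Rightarrow> nat \<Rightarrow> (nat \<Rightarrow> nat) \<Rightarrow> (nat \<Rightarrow> real) \<Rightarrow> complex vec" where
  "target_state n M k l \<theta> =
     finsum_vec TYPE(complex) (2 ^ n)
       (\<lambda>r. complex_of_real (coeff_gamma k l \<theta> r) \<cdot>\<^sub>v Gamma_state n M l r) {..k}"

end

theory Submission
  imports Defs
begin

text \<open>Amplitude functions indexed by basis states replace vectors; a gate then acts by updating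
  bits of the index. After the \<open>m\<close>-th rotation and the Hadamard gates following it, the state is
  the sum of the first \<open>m\<close> terms \<open>\<gamma>\<^sub>r |\<Gamma>\<^sub>r\<rangle>\<close> and a remainder proportional to
  \<open>|\<Gamma>\<^sub>m\<rangle>\<close>. In the finished terms qubit \<open>l m\<close> and the later control qubits are \<open>1\<close>, so the
  remaining gates fix them. In the remainder qubit \<open>l m\<close> is \<open>0\<close>: the next rotation splits it into
  the next finished term and a block of length \<open>2 ^ l m\<close>, which the Hadamard gates spread to a
  block of length \<open>2 ^ l (m + 1)\<close>.\<close>

section \<open>Gates acting on amplitude functions\<close>

lemma kron_mat_carrier [simp, intro]:
  "A \<in> carrier_mat a b \<Longrightarrow> B \<in> carrier_mat c d \<Longrightarrow> kron_mat A B \<in> carrier_mat (a * c) (b * d)"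
  by (auto simp: kron_mat_def)

lemma on_qubit_carrier:
  assumes "t < n" "V \<in> carrier_mat 2 2"
  shows "on_qubit n t V \<in> carrier_mat (2 ^ n) (2 ^ n)"
proof -
  have "(2::nat) ^ (n - 1 - t) * (2 * 2 ^ t) = 2 ^ ((n - 1 - t) + Suc t)"
    by (simp add: power_add)
  also have "(n - 1 - t) + Suc t = n" using assms by simp
  finally have e: "(2::nat) ^ (n - 1 - t) * (2 * 2 ^ t) = 2 ^ n" .
  have "kron_mat (1\<^sub>m (2 ^ (n - 1 - t))) (kron_mat V (1\<^sub>m (2 ^ t)))
      \<in> carrier_mat (2 ^ (n - 1 - t) * (2 * 2 ^ t)) (2 ^ (n - 1 - t) * (2 * 2 ^ t))"
    using assms by (intro kron_mat_carrier) auto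
  then show ?thesis unfolding on_qubit_def e .
qed

text \<open>The three Kronecker factors split an index \<open>z\<close> into
  \<open>z div 2 ^ Suc t\<close>, bit \<open>t\<close> and \<open>z mod 2 ^ t\<close>; the identity
  factors force the outer pieces of row and column to agree.\<close>

lemma on_qubit_index:
  assumes "t < n" "V \<in> carrier_mat 2 2" "x < 2 ^ n" "y < 2 ^ n"
  shows "on_qubit n t V $$ (x, y) =
    (if x div 2 ^ Suc t = y div 2 ^ Suc t \<and> x mod 2 ^ t = y mod 2 ^ t
     then V $$ (of_bool (bit x t), of_bool (bit y t)) else 0)"
proof -
  have e: "(2::nat) ^ n = 2 ^ (n - 1 - t) * 2 ^ Suc t"
    using assms(1) by (simp flip: power_add power_Suc)
  have d: "z div (2 * 2 ^ t) < 2 ^ (n - 1 - t)" if "z < 2 ^ n" for z :: nat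
    using that unfolding e by (simp add: less_mult_imp_div_less)
  have b: "z mod (2 * 2 ^ t) div 2 ^ t = of_bool (bit z t)" for z :: nat
    by (simp add: bit_iff_odd mod_mult2_eq mult.commute[of 2] odd_iff_mod_2_eq_one
        flip: mod_2_eq_odd)
  have m: "z mod (2 * 2 ^ t) mod 2 ^ t = z mod 2 ^ t" for z :: nat
    by (simp add: mod_mod_cancel)
  have D: "dim_row V = 2" "dim_col V = 2" using assms(2) by auto
  show ?thesis
    using assms(3,4) d[of x] d[of y]
    by (simp add: on_qubit_def kron_mat_def D e b m)
qed

text \<open>Row \<open>x\<close> of \<open>on_qubit n t V\<close> can be nonzero only in the columns
  obtained from \<open>x\<close> by clearing or setting bit \<open>t\<close>; this is the two-term
  sum that remains.\<close>

definition single_act ::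
  "complex mat \<Rightarrow> nat \<Rightarrow> (nat \<Rightarrow> complex) \<Rightarrow> nat \<Rightarrow> complex" where
  "single_act V t f x = V $$ (of_bool (bit x t), 0) * f (unset_bit t x)
     + V $$ (of_bool (bit x t), 1) * f (set_bit t x)"

lemma single_act_scale:
  "single_act V t (\<lambda>x. \<alpha> * f x) = (\<lambda>x. \<alpha> * single_act V t f x)"
  by (simp add: fun_eq_iff single_act_def algebra_simps)

lemma set_bit_less_power:
  fixes x :: nat
  assumes "t < n" "x < 2 ^ n"
  shows "set_bit t x < 2 ^ n" "unset_bit t x < 2 ^ n"
proof -
  have "take_bit n x = x" using assms by (simp add: take_bit_nat_eq_self_iff)
  then have *: "bit x j \<Longrightarrow> j < n" for j
    by (metis bit_take_bit_iff)
  have "take_bit n (set_bit t x) = set_bit t x" "take_bit n (unset_bit t x) = unset_bit t x"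
    using * assms(1) by (auto intro!: bit_eqI simp: bit_simps)
  then show "set_bit t x < 2 ^ n" "unset_bit t x < 2 ^ n"
    by (simp_all add: take_bit_nat_eq_self_iff)
qed

text \<open>Either side means agreement in all bits except \<open>t\<close>. This matches the
  support found in \<open>on_qubit_index\<close> with the two columns of
  \<open>single_act\<close>.\<close>

lemma eq_up_to_bit_iff:
  fixes x y :: nat
  shows "x div 2 ^ Suc t = y div 2 ^ Suc t \<and> x mod 2 ^ t = y mod 2 ^ t \<longleftrightarrow>
    y = unset_bit t x \<or> y = set_bit t x"
    (is "?L \<longleftrightarrow> ?R")
proof -
  have "?L \<longleftrightarrow> drop_bit (Suc t) x = drop_bit (Suc t) y \<and> take_bit t x = take_bit t y"
    by (simp only: drop_bit_eq_div take_bit_eq_mod)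
  also have "\<dots> \<longleftrightarrow> (\<forall>j. j \<noteq> t \<longrightarrow> bit x j = bit y j)"
  proof
    assume a: "drop_bit (Suc t) x = drop_bit (Suc t) y \<and> take_bit t x = take_bit t y"
    show "\<forall>j. j \<noteq> t \<longrightarrow> bit x j = bit y j"
    proof (intro allI impI)
      fix j assume "j \<noteq> t"
      then consider "j < t" | i where "j = Suc t + i"
        by (metis linorder_neqE_nat less_imp_Suc_add add_Suc)
      then show "bit x j = bit y j"
      proof cases
        case 1 then show ?thesis using a by (metis bit_take_bit_iff)
      next
        case 2 then show ?thesis using a by (metis bit_drop_bit_eq comp_apply)
      qed
    qed
  qed (auto intro!: bit_eqI simp: bit_simps)
  also have "\<dots> \<longleftrightarrow> ?R"
  proof
    assume a: "\<forall>j. j \<noteq> t \<longrightarrow> bit x j = bit y j"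
    show ?R
    proof (cases "bit y t")
      case True
      then have "y = set_bit t x" using a by (auto intro!: bit_eqI simp: bit_simps)
      then show ?thesis ..
    next
      case False
      then have "y = unset_bit t x" using a by (auto intro!: bit_eqI simp: bit_simps)
      then show ?thesis ..
    qed
  qed (auto simp: bit_simps)
  finally show ?thesis .
qed

lemma on_qubit_mult_vec:
  assumes "t < n" "V \<in> carrier_mat 2 2"
  shows "on_qubit n t V *\<^sub>v vec (2 ^ n) f = vec (2 ^ n) (single_act V t f)"
proof (rule eq_vecI)
  have C: "on_qubit n t V \<in> carrier_mat (2 ^ n) (2 ^ n)"
    using assms by (rule on_qubit_carrier)
  show "dim_vec (on_qubit n t V *\<^sub>v vec (2 ^ n) f) = dim_vec (vec (2 ^ n) (single_act V t f))"
    using C by simp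
  fix x assume "x < dim_vec (vec (2 ^ n) (single_act V t f))"
  then have x: "x < 2 ^ n" by simp
  let ?S = "{unset_bit t x, set_bit t x}"
  have "(on_qubit n t V *\<^sub>v vec (2 ^ n) f) $ x
      = (\<Sum>y<2 ^ n. on_qubit n t V $$ (x, y) * f y)"
    using C x by (simp add: scalar_prod_def lessThan_atLeast0)
  also have "\<dots> = (\<Sum>y<2 ^ n. if y \<in> ?S
      then V $$ (of_bool (bit x t), of_bool (bit y t)) * f y else 0)"
    using x by (intro sum.cong refl, subst on_qubit_index[OF assms], simp, simp)
      (simp only: eq_up_to_bit_iff, simp)
  \<comment> \<open>Both columns lie below \<open>2 ^ n\<close>, so passing to the two-element index
    set loses nothing.\<close>
  also have "\<dots> = (\<Sum>y\<in>?S. V $$ (of_bool (bit x t), of_bool (bit y t)) * f y)"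
    using set_bit_less_power[OF assms(1) x]
    by (subst sum.inter_restrict[symmetric]) (auto intro!: sum.cong)
  also have "\<dots> = single_act V t f x"
  proof -
    have "unset_bit t x \<noteq> set_bit t x"
      by (metis bit_set_bit_iff bit_unset_bit_iff possible_bit_nat)
    then show ?thesis
      by (simp add: single_act_def bit_simps)
  qed
  finally show "(on_qubit n t V *\<^sub>v vec (2 ^ n) f) $ x = vec (2 ^ n) (single_act V t f) $ x"
    using x by simp
qed

section \<open>From gates to whole circuits and basis kets\<close>

fun gate_act :: "gate \<Rightarrow> (nat \<Rightarrow> complex) \<Rightarrow> nat \<Rightarrow> complex" where
  "gate_act (Single V t) f = single_act (single_mat V) t f"
| "gate_act (Ctrl0 V c t) f = (\<lambda>x. if bit x c then f x else single_act (single_mat V) t f x)"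

lemma single_mat_carrier: "single_mat V \<in> carrier_mat 2 2"
  by (cases V) (auto simp: mat_of_rows_list_def)

lemma gate_mat_carrier: "gate_on n g \<Longrightarrow> gate_mat n g \<in> carrier_mat (2 ^ n) (2 ^ n)"
  by (cases g)
    (auto intro!: add_carrier_mat mult_carrier_mat on_qubit_carrier single_mat_carrier
      simp: mat_of_rows_list_def)

lemma gate_mat_mult_vec:
  assumes "gate_on n g"
  shows "gate_mat n g *\<^sub>v vec (2 ^ n) f = vec (2 ^ n) (gate_act g f)"
proof (cases g)
  case (Single V t)
  then show ?thesis using assms by (simp add: on_qubit_mult_vec single_mat_carrier)
next
  case (Ctrl0 V c t)
  let ?P0 = "mat_of_rows_list 2 [[1, 0], [0, 0 :: complex]]"
  let ?P1 = "mat_of_rows_list 2 [[0, 0], [0, 1 :: complex]]"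
  have ct: "c < n" "t < n" using assms Ctrl0 by auto
  have P: "?P0 \<in> carrier_mat 2 2" "?P1 \<in> carrier_mat 2 2"
    by (auto simp: mat_of_rows_list_def)
  \<comment> \<open>Where the projection keeps \<open>x\<close>, bit \<open>c\<close> of
    \<open>x\<close> already has the value being written, so the updated index is \<open>x\<close>
    itself.\<close>
  have P0: "single_act ?P0 c h = (\<lambda>x. if bit x c then 0 else h x)" for h
    by (auto simp: fun_eq_iff single_act_def mat_of_rows_list_def intro!: arg_cong[of _ _ h] bit_eqI
        simp: bit_simps)
  have P1: "single_act ?P1 c h = (\<lambda>x. if bit x c then h x else 0)" for h
    by (auto simp: fun_eq_iff single_act_def mat_of_rows_list_def intro!: arg_cong[of _ _ h] bit_eqI
        simp: bit_simps)
  note C = on_qubit_carrier[OF ct(1) P(1)] on_qubit_carrier[OF ct(1) P(2)]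
    on_qubit_carrier[OF ct(2) single_mat_carrier]
  have "gate_mat n g *\<^sub>v vec (2 ^ n) f =
    on_qubit n c ?P0 *\<^sub>v (on_qubit n t (single_mat V) *\<^sub>v vec (2 ^ n) f)
      + on_qubit n c ?P1 *\<^sub>v vec (2 ^ n) f"
    using Ctrl0 C
    by (simp add: add_mult_distrib_mat_vec[where nr="2^n" and nc="2^n"]
        assoc_mult_mat_vec[where n\<^sub>1="2^n" and n\<^sub>2="2^n" and n\<^sub>3="2^n"])
  also have "\<dots> = vec (2 ^ n) (gate_act g f)"
    using Ctrl0 by (auto simp: on_qubit_mult_vec[OF ct(1) P(1)] on_qubit_mult_vec[OF ct(1) P(2)]
        on_qubit_mult_vec[OF ct(2) single_mat_carrier] P0 P1)
  finally show ?thesis .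
qed

lemma circuit_mat_carrier:
  "circuit_on n gs \<Longrightarrow> circuit_mat n gs \<in> carrier_mat (2 ^ n) (2 ^ n)"
proof (induction gs)
  case (Cons g gs)
  then show ?case
    by (auto simp: circuit_on_def intro!: mult_carrier_mat gate_mat_carrier)
qed simp

text \<open>Later gates multiply from the left in \<open>circuit_mat\<close>, so by associativity
  the head gate meets the vector first, which is the order of \<open>fold\<close>.\<close>

lemma circuit_mat_mult_vec:
  "circuit_on n gs \<Longrightarrow> circuit_mat n gs *\<^sub>v vec (2 ^ n) f = vec (2 ^ n) (fold gate_act gs f)"
proof (induction gs arbitrary: f)
  case (Cons g gs)
  then have "gate_on n g" "circuit_on n gs" by (auto simp: circuit_on_def)
  then show ?case
    using Cons.IH[of "gate_act g f"]
    by (simp add: assoc_mult_mat_vec[OF circuit_mat_carrier gate_mat_carrier] gate_mat_mult_vec)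
qed simp

text \<open>The leading factor supplies the digit of weight \<open>2 ^ n\<close>, the remaining
  factors the residue modulo \<open>2 ^ n\<close>. The residue appears because \<open>ket\<close>
  reads only the low digits of \<open>j\<close>.\<close>

lemma ket_eq_unit_vec: "ket n j = unit_vec (2 ^ n) (j mod 2 ^ n)"
proof (induction n)
  case (Suc n)
  show ?case
  proof (rule eq_vecI)
    show "dim_vec (ket (Suc n) j) = dim_vec (unit_vec (2 ^ Suc n) (j mod 2 ^ Suc n))"
      by (simp add: Suc kron_vec_def)
    fix i assume "i < dim_vec (unit_vec (2 ^ Suc n) (j mod 2 ^ Suc n))"
    then have i: "i < 2 * 2 ^ n" by simp
    have d: "i div 2 ^ n < 2" using i by (simp add: less_mult_imp_div_less)
    have "i = j mod (2 ^ n * 2) \<longleftrightarrow> i div 2 ^ n = j div 2 ^ n mod 2 \<and> i mod 2 ^ n = j mod 2 ^ n"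
    proof
      assume "i = j mod (2 ^ n * 2)"
      then have "i = 2 ^ n * (j div 2 ^ n mod 2) + j mod 2 ^ n" by (simp add: mod_mult2_eq)
      then show "i div 2 ^ n = j div 2 ^ n mod 2 \<and> i mod 2 ^ n = j mod 2 ^ n" by simp
    next
      assume "i div 2 ^ n = j div 2 ^ n mod 2 \<and> i mod 2 ^ n = j mod 2 ^ n"
      then have "i = 2 ^ n * (j div 2 ^ n mod 2) + j mod 2 ^ n"
        by (metis mult_div_mod_eq)
      then show "i = j mod (2 ^ n * 2)" by (simp add: mod_mult2_eq)
    qed
    then show "ket (Suc n) j $ i = unit_vec (2 ^ Suc n) (j mod 2 ^ Suc n) $ i"
      using i d by (auto simp: Suc kron_vec_def mult.commute)
  qed
qed auto

section \<open>Blocks of consecutive basis states\<close>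

text \<open>Indicator of the aligned interval of length \<open>2 ^ i\<close> containing
  \<open>c\<close>. Phrased through bits, because gates act by updating single bits.\<close>

definition block :: "nat \<Rightarrow> nat \<Rightarrow> nat \<Rightarrow> complex" where
  "block i c x = of_bool (\<forall>j\<ge>i. bit x j = bit c j)"

text \<open>Qubit \<open>t\<close> is 0 throughout the block, and \<open>H\<close> sends that value
  to both values with equal amplitude \<open>1 / sqrt 2\<close>; the block doubles in
  length.\<close>

lemma block_Hadamard:
  assumes "\<not> bit c t"
  shows "single_act (single_mat Hadamard) t (block t c) x = block (Suc t) c x / sqrt 2"
proof -
  have u: "block t c (unset_bit t x) = block (Suc t) c x"
  proof -
    have "(\<forall>j\<ge>t. bit (unset_bit t x) j = bit c j) \<longleftrightarrow> (\<forall>j\<ge>Suc t. bit x j = bit c j)"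
    proof (rule iffI; intro allI impI)
      fix j assume "\<forall>j\<ge>t. bit (unset_bit t x) j = bit c j" "Suc t \<le> j"
      then show "bit x j = bit c j" by (auto simp: bit_simps dest: spec[of _ j])
    next
      fix j assume "\<forall>j\<ge>Suc t. bit x j = bit c j" "t \<le> j"
      then show "bit (unset_bit t x) j = bit c j"
        using assms by (cases "j = t") (auto simp: bit_simps)
    qed
    then show ?thesis by (simp add: block_def)
  qed
  have s: "block t c (set_bit t x) = 0"
    using assms by (auto simp: block_def bit_simps)
  show ?thesis
    by (auto simp: single_act_def u s mat_of_rows_list_def)
qed

text \<open>As \<open>i \<le> t\<close>, qubit \<open>t\<close> is 1 throughout the block. The
  second column of the rotation then gives amplitude \<open>- sin\<close> with the bit cleared and
  \<open>cos\<close> with the bit kept.\<close>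

lemma block_RotY:
  assumes "\<not> bit c t" "i \<le> t"
  shows "single_act (single_mat (RotY \<theta>)) t (block i (set_bit t c)) x =
    - of_real (sin (\<theta> / 2)) * block i c x + of_real (cos (\<theta> / 2)) * block i (set_bit t c) x"
proof -
  have u: "block i (set_bit t c) (unset_bit t x) = 0"
    using assms by (auto simp: block_def bit_simps)
  have s: "block i (set_bit t c) (set_bit t x) = (if bit x t then block i (set_bit t c) x else block i c x)"
    using assms by (auto simp: block_def bit_simps)
  have v: "bit x t \<Longrightarrow> block i c x = 0" "\<not> bit x t \<Longrightarrow> block i (set_bit t c) x = 0"
    using assms by (auto simp: block_def bit_simps)
  show ?thesis
    using v by (auto simp: single_act_def u s mat_of_rows_list_def)
qed

lemma block_PauliX:
  assumes "\<not> bit c t"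
  shows "single_act (single_mat PauliX) t (block 0 c) = block 0 (set_bit t c)"
proof
  fix x
  have s: "block 0 c (set_bit t x) = 0" "\<not> bit x t \<Longrightarrow> block 0 (set_bit t c) x = 0"
    using assms by (auto simp: block_def bit_simps)
  have u: "bit x t \<Longrightarrow> block 0 c (unset_bit t x) = block 0 (set_bit t c) x"
    using assms by (auto simp: block_def bit_simps)
  show "single_act (single_mat PauliX) t (block 0 c) x = block 0 (set_bit t c) x"
    using s u by (cases "bit x t") (auto simp: single_act_def mat_of_rows_list_def)
qed

text \<open>\<open>u\<close> lives where the control is 1 and \<open>v\<close> where it is 0. The
  gate changes only bit \<open>t\<close>, which differs from \<open>c\<close>, so the two supports
  never mix.\<close>

lemma Ctrl0_act_split:
  assumes "c \<noteq> t" "\<And>x. \<not> bit x c \<Longrightarrow> u x = 0" "\<And>x. bit x c \<Longrightarrow> v x = 0"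
  shows "gate_act (Ctrl0 V c t) (\<lambda>x. u x + \<alpha> * v x)
    = (\<lambda>x. u x + \<alpha> * single_act (single_mat V) t v x)"
  using assms by (auto simp: fun_eq_iff single_act_def bit_simps algebra_simps)

text \<open>With targets in increasing order each gate doubles the block and contributes
  \<open>1 / sqrt 2\<close>, so the normalisation always matches the length. \<open>u\<close> is a
  spectator; the abstract \<open>g\<close> covers plain and controlled Hadamard gates.\<close>

lemma Hadamard_ladder:
  assumes "p \<le> q" "\<And>t. p \<le> t \<Longrightarrow> t < q \<Longrightarrow> \<not> bit c t"
    and g: "\<And>t \<alpha>. p \<le> t \<Longrightarrow> t < q \<Longrightarrow> gate_act (g t) (\<lambda>x. u x + \<alpha> * block t c x)
      = (\<lambda>x. u x + \<alpha> * single_act (single_mat Hadamard) t (block t c) x)"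
  shows "fold gate_act (map g [p..<q]) (\<lambda>x. u x + of_real (r / sqrt (2 ^ p)) * block p c x)
    = (\<lambda>x. u x + of_real (r / sqrt (2 ^ q)) * block q c x)"
  using assms
proof (induction q rule: dec_induct)
  case (step q)
  have "fold gate_act (map g [p..<q]) (\<lambda>x. u x + of_real (r / sqrt (2 ^ p)) * block p c x)
    = (\<lambda>x. u x + of_real (r / sqrt (2 ^ q)) * block q c x)"
    using step.prems by (intro step.IH) auto
  moreover have "gate_act (g q) (\<lambda>x. u x + of_real (r / sqrt (2 ^ q)) * block q c x)
    = (\<lambda>x. u x + of_real (r / sqrt (2 ^ Suc q)) * block (Suc q) c x)"
    using step.prems(1)[of q] step.prems(2)[OF step.hyps(1) lessI, of "of_real (r / sqrt (2 ^ q))"]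
      step.hyps(1)
    by (simp add: block_Hadamard real_sqrt_mult mult.commute del: single_mat.simps)
  ultimately show ?case
    using step.hyps by simp
qed simp

section \<open>Sums of powers of two\<close>

lemma bit_add_power:
  fixes a :: nat
  assumes "\<not> bit a t"
  shows "a + 2 ^ t = set_bit t a"
proof -
  have "a + 2 ^ t = or a (2 ^ t)"
    using assms by (intro disjunctive_add_eq_or bit_eqI) (auto simp: bit_simps)
  also have "\<dots> = set_bit t a"
    by (auto intro!: bit_eqI simp: bit_simps)
  finally show ?thesis .
qed

text \<open>Distinct exponents produce no carries, so the exponents are exactly the binary digits
  equal to 1.\<close>

lemma bit_sum_power:
  fixes l :: "'a \<Rightarrow> nat"
  assumes "finite A" "inj_on l A"
  shows "bit (\<Sum>s\<in>A. 2 ^ l s :: nat) j \<longleftrightarrow> j \<in> l ` A"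
  using assms
proof (induction A arbitrary: j rule: finite_induct)
  case (insert a A)
  then have "\<not> bit (\<Sum>s\<in>A. 2 ^ l s :: nat) (l a)" by auto
  then have "(\<Sum>s\<in>insert a A. 2 ^ l s) = set_bit (l a) (\<Sum>s\<in>A. 2 ^ l s :: nat)"
    using insert.hyps by (simp add: bit_add_power add.commute[of "2 ^ l a"])
  then show ?case
    using insert by (auto simp: bit_simps)
qed simp

section \<open>The stages of the circuit\<close>

text \<open>The first label of \<open>\<Gamma>_m\<close>, that is, \<open>M\<close> minus its powers
  up to index \<open>m\<close>. Written as a sum, it shows its binary digits and avoids truncated
  subtraction.\<close>

definition tail_sum :: "nat \<Rightarrow> (nat \<Rightarrow> nat) \<Rightarrow> nat \<Rightarrow> nat" where
  "tail_sum k l m = (\<Sum>s\<in>{m<..k}. 2 ^ l s)"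

definition finished_part ::
  "nat \<Rightarrow> (nat \<Rightarrow> nat) \<Rightarrow> (nat \<Rightarrow> real) \<Rightarrow> nat \<Rightarrow> nat \<Rightarrow> complex" where
  "finished_part k l \<theta> m x =
    (\<Sum>r<m. of_real (coeff_gamma k l \<theta> r) * block (l r) (tail_sum k l r) x)"

definition stage_state ::
  "nat \<Rightarrow> (nat \<Rightarrow> nat) \<Rightarrow> (nat \<Rightarrow> real) \<Rightarrow> nat \<Rightarrow> nat \<Rightarrow> complex" where
  "stage_state k l \<theta> m x = finished_part k l \<theta> m x
    + of_real ((\<Prod>s<m. amp_a \<theta> s) / sqrt (2 ^ l m)) * block (l m) (tail_sum k l m) x"

lemma fold_PauliX:
  assumes "inj_on l {1..<Suc j}"
  shows "fold gate_act (map (\<lambda>i. Single PauliX (l i)) [1..<Suc j]) (block 0 0)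
    = block 0 (\<Sum>s\<in>{1..<Suc j}. 2 ^ l s)"
  using assms
proof (induction j)
  case (Suc j)
  have i: "inj_on l {1..<Suc j}" using Suc.prems by (rule inj_on_subset) auto
  have nb: "\<not> bit (\<Sum>s\<in>{1..<Suc j}. 2 ^ l s :: nat) (l (Suc j))"
    using Suc.prems by (subst bit_sum_power[OF _ i]) (auto simp: inj_on_eq_iff)
  have "(\<Sum>s\<in>{1..<Suc (Suc j)}. 2 ^ l s) = set_bit (l (Suc j)) (\<Sum>s\<in>{1..<Suc j}. 2 ^ l s :: nat)"
    using nb by (simp add: bit_add_power)
  then show ?case
    using Suc.IH[OF i] block_PauliX[OF nb] by (simp del: single_mat.simps)
qed simp

section \<open>Digits of the tail sums\<close>

context
  fixes k :: nat and l :: "nat \<Rightarrow> nat"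
  assumes mono: "strict_mono_on {..k} l"
begin

lemma l_less_iff: "r \<le> k \<Longrightarrow> s \<le> k \<Longrightarrow> l r < l s \<longleftrightarrow> r < s"
  using mono by (simp add: strict_mono_on_less)

lemma l_eq_iff: "r \<le> k \<Longrightarrow> s \<le> k \<Longrightarrow> l r = l s \<longleftrightarrow> r = s"
  using strict_mono_on_imp_inj_on[OF mono] by (simp add: inj_on_eq_iff)

text \<open>Needed at \<open>r = k\<close>, where it bounds the gate count
  \<open>l k + 2 * k\<close> by \<open>3 * l k\<close>.\<close>

lemma index_le: "r \<le> k \<Longrightarrow> r \<le> l r"
proof (induction r)
  case (Suc r)
  then show ?case using l_less_iff[of r "Suc r"] by simp
qed simp

lemma bit_tail_sum: "bit (tail_sum k l m) j \<longleftrightarrow> j \<in> l ` {m<..k}"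
  unfolding tail_sum_def
  by (rule bit_sum_power) (auto intro: inj_on_subset[OF strict_mono_on_imp_inj_on[OF mono]])

lemma not_bit_tail_sum: "m \<le> k \<Longrightarrow> t \<le> l m \<Longrightarrow> \<not> bit (tail_sum k l m) t"
  using l_less_iff[of m] by (fastforce simp: bit_tail_sum)

lemma tail_sum_Suc:
  assumes "m < k"
  shows "tail_sum k l m = set_bit (l (Suc m)) (tail_sum k l (Suc m))"
proof -
  have "{m<..k} = insert (Suc m) {Suc m<..k}" using assms by auto
  then show ?thesis
    using not_bit_tail_sum[of "Suc m" "l (Suc m)"] assms
    by (simp add: tail_sum_def flip: bit_add_power)
qed

section \<open>One stage of the circuit\<close>

text \<open>For \<open>r < m\<close> the power \<open>2 ^ l m\<close> belongs to the tail sum of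
  \<open>r\<close>, and \<open>l m\<close> is above the free digits of that block, so qubit
  \<open>l m\<close> is 1 there. This is the condition on \<open>u\<close> in
  \<open>Ctrl0_act_split\<close>.\<close>

lemma finished_part_eq_0:
  assumes "m \<le> k" "\<not> bit x (l m)"
  shows "finished_part k l \<theta> m x = 0"
  unfolding finished_part_def
proof (rule sum.neutral, intro ballI)
  fix r assume "r \<in> {..<m}"
  then have "l r \<le> l m" "bit (tail_sum k l r) (l m)"
    using assms by (auto simp: bit_tail_sum less_imp_le l_less_iff)
  then show "of_real (coeff_gamma k l \<theta> r) * block (l r) (tail_sum k l r) x = 0"
    using assms(2) by (auto simp: block_def)
qed

text \<open>The tail sum has digit 0 at \<open>l m\<close>, and the block fixes that digit. This is
  the condition on \<open>v\<close> in \<open>Ctrl0_act_split\<close>, for every intermediate length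
  \<open>2 ^ i\<close> of the ladder.\<close>

lemma block_tail_sum_eq_0:
  assumes "m \<le> k" "i \<le> l m" "bit x (l m)"
  shows "block i (tail_sum k l m) x = 0"
  using assms not_bit_tail_sum[of m "l m"] by (auto simp: block_def)

lemma single_RotY_block:
  assumes "m < k"
  shows "single_act (single_mat (RotY (\<theta> m))) (l (Suc m)) (block (l m) (tail_sum k l m)) x =
    of_real (amp_a \<theta> m) * block (l m) (tail_sum k l (Suc m)) x
    + of_real (amp_b \<theta> m) * block (l m) (tail_sum k l m) x"
  using assms not_bit_tail_sum[of "Suc m" "l (Suc m)"] l_less_iff[of m "Suc m"]
  unfolding tail_sum_Suc[OF assms]
  by (subst block_RotY) (auto simp: amp_a_def amp_b_def)

text \<open>The cosine branch of rotation \<open>m\<close> carries exactly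
  \<open>coeff_gamma\<close> at \<open>m\<close>; for \<open>m = 0\<close> the product is
  empty.\<close>

lemma finished_part_Suc:
  assumes "m < k"
  shows "finished_part k l \<theta> (Suc m) x = finished_part k l \<theta> m x
    + of_real ((\<Prod>s<m. amp_a \<theta> s) / sqrt (2 ^ l m))
      * (of_real (amp_b \<theta> m) * block (l m) (tail_sum k l m) x)"
  using assms by (auto simp: finished_part_def coeff_gamma_def)

text \<open>The first rotation is uncontrolled, hence the general first gate \<open>g\<close>.\<close>

lemma stage_step:
  assumes m: "m < k"
    and g: "gate_act g (stage_state k l \<theta> m) = (\<lambda>x. finished_part k l \<theta> m x
      + of_real ((\<Prod>s<m. amp_a \<theta> s) / sqrt (2 ^ l m))
        * single_act (single_mat (RotY (\<theta> m))) (l (Suc m)) (block (l m) (tail_sum k l m)) x)"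
  shows "fold gate_act (g # map (Ctrl0 Hadamard (l (Suc m))) [l m..<l (Suc m)])
    (stage_state k l \<theta> m) = stage_state k l \<theta> (Suc m)"
proof -
  \<comment> \<open>The cosine branch joins the finished terms. The sine branch extends the product
    by \<open>amp_a \<theta> m\<close>, while its block still has length
    \<open>2 ^ l m\<close>.\<close>
  have "gate_act g (stage_state k l \<theta> m) = (\<lambda>x. finished_part k l \<theta> (Suc m) x
      + of_real ((\<Prod>s<Suc m. amp_a \<theta> s) / sqrt (2 ^ l m)) * block (l m) (tail_sum k l (Suc m)) x)"
    unfolding g single_RotY_block[OF m] finished_part_Suc[OF m]
    by (simp add: fun_eq_iff algebra_simps)
  moreover have "fold gate_act (map (Ctrl0 Hadamard (l (Suc m))) [l m..<l (Suc m)]) \<dots>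
      = stage_state k l \<theta> (Suc m)"
    unfolding stage_state_def
  proof (rule Hadamard_ladder)
    show "l m \<le> l (Suc m)" using m by (simp add: less_imp_le l_less_iff)
    show "\<not> bit (tail_sum k l (Suc m)) t" if "t < l (Suc m)" for t
      using m that by (intro not_bit_tail_sum) auto
    show "gate_act (Ctrl0 Hadamard (l (Suc m)) t)
        (\<lambda>x. finished_part k l \<theta> (Suc m) x + \<alpha> * block t (tail_sum k l (Suc m)) x)
      = (\<lambda>x. finished_part k l \<theta> (Suc m) x
        + \<alpha> * single_act (single_mat Hadamard) t (block t (tail_sum k l (Suc m))) x)"
      if "t < l (Suc m)" for t \<alpha>
      using m that
      by (intro Ctrl0_act_split) (auto intro: finished_part_eq_0 block_tail_sum_eq_0)
  qed
  ultimately show ?thesis by (simp del: gate_act.simps)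
qed

lemma fold_stages:
  assumes "Suc 0 \<le> m" "m \<le> k"
  shows "fold gate_act (concat (map (\<lambda>m. Ctrl0 (RotY (\<theta> m)) (l m) (l (m + 1))
      # map (\<lambda>i. Ctrl0 Hadamard (l (m + 1)) i) [l m..<l (m + 1)]) [1..<m]))
    (stage_state k l \<theta> 1) = stage_state k l \<theta> m"
  using assms
proof (induction m rule: dec_induct)
  case (step m)
  have "gate_act (Ctrl0 (RotY (\<theta> m)) (l m) (l (Suc m))) (stage_state k l \<theta> m)
    = (\<lambda>x. finished_part k l \<theta> m x
      + of_real ((\<Prod>s<m. amp_a \<theta> s) / sqrt (2 ^ l m))
        * single_act (single_mat (RotY (\<theta> m))) (l (Suc m)) (block (l m) (tail_sum k l m)) x)"
    unfolding stage_state_def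
    using step.hyps step.prems
    by (intro Ctrl0_act_split) (auto simp: l_eq_iff finished_part_eq_0 block_tail_sum_eq_0)
  then have "fold gate_act (Ctrl0 (RotY (\<theta> m)) (l m) (l (Suc m))
        # map (Ctrl0 Hadamard (l (Suc m))) [l m..<l (Suc m)]) (stage_state k l \<theta> m)
      = stage_state k l \<theta> (Suc m)"
    using step.prems by (intro stage_step) auto
  then show ?case
    using step by (simp del: gate_act.simps single_mat.simps)
qed simp

lemma fold_U_circuit:
  assumes "1 \<le> k"
  shows "fold gate_act (U_circuit k l \<theta>) (block 0 0) = stage_state k l \<theta> k"
proof -
  \<comment> \<open>The redundant \<open>0 +\<close> and \<open>1 / sqrt (2 ^ 0)\<close> give the
    state the shape of \<open>Hadamard_ladder\<close> with zero spectator and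
    \<open>p = 0\<close>.\<close>
  have X: "fold gate_act (map (\<lambda>i. Single PauliX (l i)) [1..<k + 1]) (block 0 0)
    = (\<lambda>x. 0 + of_real (1 / sqrt (2 ^ 0)) * block 0 (tail_sum k l 0) x)"
  proof -
    have "{1..<Suc k} = {0<..k}" by auto
    then show ?thesis
      using fold_PauliX[of l k] inj_on_subset[OF strict_mono_on_imp_inj_on[OF mono], of "{0<..k}"]
      by (simp add: tail_sum_def subset_eq del: upt_Suc)
  qed
  have H: "fold gate_act (map (Single Hadamard) [0..<l 0]) \<dots> = stage_state k l \<theta> 0"
  proof -
    have "fold gate_act (map (Single Hadamard) [0..<l 0])
        (\<lambda>x. 0 + of_real (1 / sqrt (2 ^ 0)) * block 0 (tail_sum k l 0) x)
      = (\<lambda>x. 0 + of_real (1 / sqrt (2 ^ l 0)) * block (l 0) (tail_sum k l 0) x)"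
      by (rule Hadamard_ladder)
        (auto simp: single_act_scale not_bit_tail_sum simp del: single_mat.simps)
    then show ?thesis by (simp add: stage_state_def finished_part_def fun_eq_iff)
  qed
  \<comment> \<open>At stage 0 there is no finished term to protect, so the rotation needs no
    control.\<close>
  have "gate_act (Single (RotY (\<theta> 0)) (l 1)) (stage_state k l \<theta> 0) = (\<lambda>x. finished_part k l \<theta> 0 x
      + of_real ((\<Prod>s<0. amp_a \<theta> s) / sqrt (2 ^ l 0))
        * single_act (single_mat (RotY (\<theta> 0))) (l (Suc 0)) (block (l 0) (tail_sum k l 0)) x)"
    by (simp add: stage_state_def[abs_def] finished_part_def single_act_def fun_eq_iff
        add_divide_distrib del: single_mat.simps)
  then have R: "fold gate_act (Single (RotY (\<theta> 0)) (l 1)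
      # map (Ctrl0 Hadamard (l (Suc 0))) [l 0..<l (Suc 0)]) (stage_state k l \<theta> 0)
      = stage_state k l \<theta> (Suc 0)"
    using assms by (intro stage_step) auto
  show ?thesis
    unfolding U_circuit_def
    using fold_stages[OF assms[unfolded One_nat_def] order_refl, of \<theta>] R
    by (simp only: fold_append comp_apply X[unfolded One_nat_def] H fold.simps append_Cons
        append_Nil id_apply One_nat_def)
qed

section \<open>Gate count and validity of the circuit\<close>

lemma length_U_circuit:
  assumes "1 \<le> k"
  shows "length (U_circuit k l \<theta>) = l k + 2 * k"
proof -
  \<comment> \<open>The Hadamard counts telescope; each \<open>Suc\<close> counts a controlled
    rotation, and \<open>l 1 + 1\<close> counts the Hadamard gates and the rotation before the
    loop.\<close>
  have "sum_list (map (\<lambda>m. Suc (l (Suc m) - l m)) [1..<m]) + l 1 + 1 = l m + m"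
    if "Suc 0 \<le> m" "m \<le> k" for m
    using that
  proof (induction m rule: dec_induct)
    case (step m)
    then show ?case using l_less_iff[of m "Suc m"] by simp
  qed simp
  from this[of k] show ?thesis
    using assms l_less_iff[of 0 1]
    by (simp add: U_circuit_def length_concat comp_def)
qed

lemma circuit_on_U_circuit:
  assumes "1 \<le> k" "l k < n"
  shows "circuit_on n (U_circuit k l \<theta>)"
proof -
  have le: "r \<le> k \<Longrightarrow> l r < n" for r
    using assms(2) l_less_iff[of r k] by (cases "r = k") auto
  have lt: "i < l r \<Longrightarrow> r \<le> k \<Longrightarrow> i < n" for i r
    using le[of r] by simp
  have "0 \<le> k" "Suc 0 \<le> k" and Suc_le: "\<And>m. m < k \<Longrightarrow> Suc m \<le> k"
    using assms(1) by auto
  note lt' = lt[OF _ this(1)] lt[OF _ this(2)] lt[OF _ Suc_le]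
  show ?thesis
    using assms(1) unfolding circuit_on_def U_circuit_def
    by (auto simp: l_eq_iff le dest: lt')
qed

end

section \<open>The target state\<close>

lemma block_eq_div: "block i c x = of_bool (x div 2 ^ i = c div 2 ^ i)"
proof -
  have "(\<forall>j\<ge>i. bit x j = bit c j) \<longleftrightarrow> drop_bit i x = drop_bit i c"
    by (auto simp: bit_eq_iff bit_simps) (metis le_add_diff_inverse)+
  then show ?thesis by (simp add: block_def drop_bit_eq_div)
qed

text \<open>Since \<open>c\<close> is a multiple of \<open>2 ^ i\<close>, the interval starting at
  \<open>c\<close> is a full quotient class, and the only possible \<open>j\<close> is
  \<open>x mod 2 ^ i\<close>.\<close>

lemma sum_of_bool_block:
  assumes "2 ^ i dvd c"
  shows "(\<Sum>j<2 ^ i. of_bool (x = j + c)) = block i c x"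
proof -
  obtain d where d: "c = 2 ^ i * d" using assms by blast
  have "(\<Sum>j<2 ^ i. of_bool (x = j + c) :: complex) = (\<Sum>j<2 ^ i. if j = x mod 2 ^ i then
      of_bool (x div 2 ^ i = d) else 0)"
  proof (rule sum.cong[OF refl])
    fix j assume "j \<in> {..<(2::nat) ^ i}"
    then have "x = j + c \<longleftrightarrow> j = x mod 2 ^ i \<and> x div 2 ^ i = d"
      unfolding d by auto
    then show "of_bool (x = j + c) = (if j = x mod 2 ^ i then of_bool (x div 2 ^ i = d) else 0 :: complex)"
      by simp
  qed
  also have "\<dots> = block i c x" by (simp add: block_eq_div d)
  finally show ?thesis .
qed

lemma dvd_tail_sum:
  assumes "strict_mono_on {..k} l" "r \<le> k"
  shows "2 ^ l r dvd tail_sum k l r"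
  unfolding tail_sum_def
  using assms by (intro dvd_sum le_imp_power_dvd) (auto simp: strict_mono_on_def less_imp_le)

lemma Gamma_state_eq_block:
  assumes mono: "strict_mono_on {..k} l" and M: "M = (\<Sum>j\<le>k. 2 ^ l j)" "M < 2 ^ n" and r: "r \<le> k"
  shows "Gamma_state n M l r = vec (2 ^ n) (block (l r) (tail_sum k l r))"
proof -
  have "{..k} = {..r} \<union> {r<..k}" using r by auto
  then have M': "M = (\<Sum>s\<le>r. 2 ^ l s) + tail_sum k l r"
    unfolding M(1) tail_sum_def by (subst sum.union_disjoint[symmetric]) auto
  \<comment> \<open>This keeps every label of the block below \<open>M\<close>, hence below
    \<open>2 ^ n\<close>, so the residue in \<open>ket_eq_unit_vec\<close> is the label
    itself.\<close>
  have "(\<Sum>s\<le>r. 2 ^ l s) \<ge> (2::nat) ^ l r"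
    by (rule member_le_sum) auto
  then have b: "2 ^ l r + tail_sum k l r < 2 ^ n" using M' M(2) by simp
  have e: "j + M - (\<Sum>s\<le>r. 2 ^ l s) = j + tail_sum k l r" for j
    using M' by simp
  show ?thesis
  proof (rule eq_vecI)
    fix x assume "x < dim_vec (vec (2 ^ n) (block (l r) (tail_sum k l r)))"
    then have x: "x < 2 ^ n" by simp
    have "Gamma_state n M l r $ x = (\<Sum>j<2 ^ l r. ket n (j + tail_sum k l r) $ x)"
      unfolding Gamma_state_def e
      by (rule index_finsum_vec) (auto simp: x ket_eq_unit_vec)
    also have "\<dots> = (\<Sum>j<2 ^ l r. of_bool (x = j + tail_sum k l r))"
      using b x by (intro sum.cong refl) (simp add: ket_eq_unit_vec)
    finally show "Gamma_state n M l r $ x = vec (2 ^ n) (block (l r) (tail_sum k l r)) $ x"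
      using x sum_of_bool_block[OF dvd_tail_sum[OF mono r]] by simp
  next
    have "Gamma_state n M l r \<in> carrier_vec (2 ^ n)"
      unfolding Gamma_state_def by (rule finsum_vec_closed) (auto simp: ket_eq_unit_vec)
    then show "dim_vec (Gamma_state n M l r) = dim_vec (vec (2 ^ n) (block (l r) (tail_sum k l r)))"
      by simp
  qed
qed

lemma target_state_eq:
  assumes mono: "strict_mono_on {..k} l" and M: "M = (\<Sum>j\<le>k. 2 ^ l j)" "M < 2 ^ n" and k: "1 \<le> k"
  shows "target_state n M k l \<theta> = vec (2 ^ n) (stage_state k l \<theta> k)"
proof (rule eq_vecI)
  note G = Gamma_state_eq_block[OF mono M]
  have F: "(\<lambda>r. complex_of_real (coeff_gamma k l \<theta> r) \<cdot>\<^sub>v Gamma_state n M l r)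
      \<in> {..k} \<rightarrow> carrier_vec (2 ^ n)"
    by (auto simp: G)
  show "dim_vec (target_state n M k l \<theta>) = dim_vec (vec (2 ^ n) (stage_state k l \<theta> k))"
    using finsum_vec_closed[OF F] by (simp add: target_state_def)
  fix x assume "x < dim_vec (vec (2 ^ n) (stage_state k l \<theta> k))"
  then have x: "x < 2 ^ n" by simp
  have "target_state n M k l \<theta> $ x
      = (\<Sum>r\<le>k. (complex_of_real (coeff_gamma k l \<theta> r) \<cdot>\<^sub>v Gamma_state n M l r) $ x)"
    unfolding target_state_def using F by (intro index_finsum_vec) (auto simp: x)
  also have "\<dots> = (\<Sum>r\<le>k. of_real (coeff_gamma k l \<theta> r) * block (l r) (tail_sum k l r) x)"
    using x by (intro sum.cong refl) (simp add: G)
  also have "\<dots> = stage_state k l \<theta> k x"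
    \<comment> \<open>The coefficient at \<open>r = k\<close> has no cosine factor, so the remainder
      of stage \<open>k\<close> is the last term. For \<open>k = 0\<close> the branch
      \<open>r = 0\<close> of \<open>coeff_gamma\<close> would apply instead.\<close>
    using k by (simp add: stage_state_def finished_part_def coeff_gamma_def flip: lessThan_Suc_atMost)
  finally show "target_state n M k l \<theta> $ x = vec (2 ^ n) (stage_state k l \<theta> k) $ x"
    using x by simp
qed

section \<open>Correctness, depth and the logarithmic bounds\<close>

lemma U_circuit_correct:
  assumes mono: "strict_mono_on {..k} l" and M: "M = (\<Sum>j\<le>k. 2 ^ l j)" "M < 2 ^ n"
    and k: "1 \<le> k" and "l k < n"
  shows "circuit_mat n (U_circuit k l \<theta>) *\<^sub>v ket n 0 = target_state n M k l \<theta>"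
proof -
  have "ket n 0 = vec (2 ^ n) (block 0 0)"
    by (intro eq_vecI) (auto simp: ket_eq_unit_vec block_eq_div)
  then show ?thesis
    using fold_U_circuit[OF mono k] target_state_eq[OF mono M k]
      circuit_mat_mult_vec[OF circuit_on_U_circuit[OF mono k assms(5)]]
    by simp
qed

text \<open>Placing each gate in a layer of its own is a layering.\<close>

lemma depth_le_length: "depth gs \<le> length gs"
  unfolding depth_def by (rule Least_le) (auto simp: layering_def intro!: exI[of _ id])

lemma not_power_imp_index_pos:
  assumes "\<nexists>p. M = 2 ^ p" "M = (\<Sum>j\<le>k. 2 ^ l j)"
  shows "1 \<le> (k::nat)"
  using assms by (cases k) auto

theorem mainTheorem3:
  shows "(\<forall>(n::nat) (M::nat) (k::nat) (l::nat \<Rightarrow> nat) (\<theta>::nat \<Rightarrow> real).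
            1 \<le> n \<and> 2 < M \<and> M < 2 ^ n \<and> (\<nexists>p. M = 2 ^ p) \<and>
            M = (\<Sum>j\<le>k. 2 ^ l j) \<and> strict_mono_on {..k} l \<and> l k \<le> n - 1 \<longrightarrow>
              (\<forall>r<k. \<bar>amp_a \<theta> r\<bar>\<^sup>2 + \<bar>amp_b \<theta> r\<bar>\<^sup>2 = 1) \<and>
              circuit_on n (U_circuit k l \<theta>) \<and>
              length (U_circuit k l \<theta>) = l k + 2 * k \<and>
              circuit_mat n (U_circuit k l \<theta>) *\<^sub>v ket n 0 = target_state n M k l \<theta>)
       \<and> (\<exists>C::real. \<forall>(n::nat) (M::nat) (k::nat) (l::nat \<Rightarrow> nat) (\<theta>::nat \<Rightarrow> real).
            2 < M \<and> (\<nexists>p. M = 2 ^ p) \<and>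
            M = (\<Sum>j\<le>k. 2 ^ l j) \<and> strict_mono_on {..k} l \<and> n = nat \<lceil>log 2 (real M)\<rceil> \<longrightarrow>
              (\<exists>gs. circuit_on n gs \<and>
                circuit_mat n gs *\<^sub>v ket n 0 = target_state n M k l \<theta> \<and>
                real (length gs) \<le> C * log 2 (real M) \<and>
                real (depth gs) \<le> C * log 2 (real M)))"
proof (rule conjI)
  show "\<forall>(n::nat) (M::nat) (k::nat) (l::nat \<Rightarrow> nat) (\<theta>::nat \<Rightarrow> real).
            1 \<le> n \<and> 2 < M \<and> M < 2 ^ n \<and> (\<nexists>p. M = 2 ^ p) \<and>
            M = (\<Sum>j\<le>k. 2 ^ l j) \<and> strict_mono_on {..k} l \<and> l k \<le> n - 1 \<longrightarrow>
              (\<forall>r<k. \<bar>amp_a \<theta> r\<bar>\<^sup>2 + \<bar>amp_b \<theta> r\<bar>\<^sup>2 = 1) \<and>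
              circuit_on n (U_circuit k l \<theta>) \<and>
              length (U_circuit k l \<theta>) = l k + 2 * k \<and>
              circuit_mat n (U_circuit k l \<theta>) *\<^sub>v ket n 0 = target_state n M k l \<theta>"
  proof (intro allI impI, elim conjE)
    fix n M k :: nat and l :: "nat \<Rightarrow> nat" and \<theta> :: "nat \<Rightarrow> real"
    assume n: "1 \<le> n" "l k \<le> n - 1" and M: "M < 2 ^ n" "\<nexists>p. M = 2 ^ p" "M = (\<Sum>j\<le>k. 2 ^ l j)"
      and mono: "strict_mono_on {..k} l"
    have k: "1 \<le> k" using M(2,3) by (rule not_power_imp_index_pos)
    have l: "l k < n" using n by simp
    show "(\<forall>r<k. \<bar>amp_a \<theta> r\<bar>\<^sup>2 + \<bar>amp_b \<theta> r\<bar>\<^sup>2 = 1) \<and>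
              circuit_on n (U_circuit k l \<theta>) \<and>
              length (U_circuit k l \<theta>) = l k + 2 * k \<and>
              circuit_mat n (U_circuit k l \<theta>) *\<^sub>v ket n 0 = target_state n M k l \<theta>"
      using circuit_on_U_circuit[OF mono k l] length_U_circuit[OF mono k]
        U_circuit_correct[OF mono M(3,1) k l]
      by (simp add: amp_a_def amp_b_def)
  qed
next
  \<comment> \<open>The constant 3 comes from \<open>l k + 2 * k\<close> gates with
    \<open>k \<le> l k\<close> and \<open>2 ^ l k \<le> M\<close>; it serves the depth as
    well.\<close>
  have "\<exists>gs. circuit_on n gs \<and>
      circuit_mat n gs *\<^sub>v ket n 0 = target_state n M k l \<theta> \<and>
      real (length gs) \<le> 3 * log 2 (real M) \<and>
      real (depth gs) \<le> 3 * log 2 (real M)"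
    if M: "2 < M" "\<nexists>p. M = 2 ^ p" "M = (\<Sum>j\<le>k. 2 ^ l j)" and mono: "strict_mono_on {..k} l"
      and n: "n = nat \<lceil>log 2 (real M)\<rceil>"
    for n M k :: nat and l :: "nat \<Rightarrow> nat" and \<theta> :: "nat \<Rightarrow> real"
  proof -
    have k: "1 \<le> k" using M(2,3) by (rule not_power_imp_index_pos)
    have "log 2 (real M) \<le> real n" unfolding n by (rule real_nat_ceiling_ge)
    then have "real M \<le> 2 ^ n"
      using M(1) by (simp add: log_le_iff powr_realpow)
    then have "M \<le> 2 ^ n" by (simp flip: of_nat_le_iff)
    \<comment> \<open>The ceiling gives only \<open>M \<le> 2 ^ n\<close>; strictness holds because
      \<open>M\<close> is not a power of two.\<close>
    with M(2) have Mn: "M < 2 ^ n" by (metis le_neq_implies_less)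
    have lM: "2 ^ l k \<le> M" unfolding M(3) by (rule member_le_sum) auto
    then have l: "l k < n" using Mn by (metis le_less_trans power_less_imp_less_exp one_less_numeral_iff semiring_norm(76))
    have "real (2 ^ l k) \<le> real M" using lM by (simp only: of_nat_le_iff)
    then have "real (l k) \<le> log 2 (real M)"
      using M(1) by (simp add: le_log_iff powr_realpow)
    moreover have "k \<le> l k" using index_le[OF mono] by simp
    ultimately have "real (length (U_circuit k l \<theta>)) \<le> 3 * log 2 (real M)"
      by (simp add: length_U_circuit[OF mono k])
    moreover from this have "real (depth (U_circuit k l \<theta>)) \<le> 3 * log 2 (real M)"
      using depth_le_length[of "U_circuit k l \<theta>"] by linarith
    ultimately show ?thesis
      using circuit_on_U_circuit[OF mono k l] U_circuit_correct[OF mono M(3) Mn k l] by blast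
  qed
  then show "\<exists>C::real. \<forall>(n::nat) (M::nat) (k::nat) (l::nat \<Rightarrow> nat) (\<theta>::nat \<Rightarrow> real).
            2 < M \<and> (\<nexists>p. M = 2 ^ p) \<and>
            M = (\<Sum>j\<le>k. 2 ^ l j) \<and> strict_mono_on {..k} l \<and> n = nat \<lceil>log 2 (real M)\<rceil> \<longrightarrow>
              (\<exists>gs. circuit_on n gs \<and>
                circuit_mat n gs *\<^sub>v ket n 0 = target_state n M k l \<theta> \<and>
                real (length gs) \<le> C * log 2 (real M) \<and>
                real (depth gs) \<le> C * log 2 (real M))"
    by blast
qed

end
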